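(* Let $W=S_n$ be the Weyl group of the root system $\Phi=\{\epsilon_i-\epsilon_j: i\neq j\}$ of type $A_{n-1}$, with bilinear form normalised so that $B(\alpha,\alpha)=2$ for all roots and parameters $k_\alpha=1$ for all $\alpha$, and let $\Omega_{S_n}=\frac14\sum_{\alpha,\beta>0}B(\alpha,\beta)s_\alpha s_\beta\in\mathbb C[S_n]$. Then: (a) $\Omega_{S_n}=\frac14\big(n(n-1)+e_{(123)}\big)$, where $e_{(123)}$ is the sum of all $3$-cycles in $\mathbb C[S_n]$. (b) $\Omega_{S_n}=\frac14\Big(\frac{n(n-1)}2+\sum_{i=1}^nT_i^2\Big)$, where $T_i=(1,i)+(2,i)+\dots+(i-1,i)$, $1\le i\le n$, are the Jucys–Murphy elements. (c) If $\lambda$ is a partition of $n$ and $\sigma_\lambda$ is the corresponding irreducible $S_n$-representation, then $\Omega_{S_n}$ acts in $\sigma_\lambda$ by the scalar $$\sigma_\lambda(\Omega_{S_n})=\frac14\Big(\frac{n(n-1)}2+\Sigma_2(\lambda)\Big),$$ where $\Sigma_k(\lambda)$ is the sum of the $k$-th powers of the contents of $\lambda$, viewed as a left-justified decreasing Young diagram.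
   Context: Positive roots: $\epsilon_i-\epsilon_j$ with $i<j$; $\alpha>0$ means $\alpha$ is positive; $s_\alpha$ is the reflection in $\alpha$ (for $\alpha=\epsilon_i-\epsilon_j$ it is the transposition $(i,j)$). The content of a box in row $r$ and column $c$ of a Young diagram is $c-r$. *)

theory Defs
  imports
    Complex_Main
    "HOL-Library.Poly_Mapping"
    "HOL-Combinatorics.Perm"
    "HOL-Combinatorics.Permutations"
begin

text \<open>
  \<^theory>\<open>HOL-Library.Poly_Mapping\<close> turns \<open>'a \<Rightarrow>\<^sub>0 'b\<close> into the convolution algebra of a monoid \<open>'a\<close>
  that is written additively (and need not be commutative). Permutations are therefore given
  their composition a second time under the name \<open>+\<close>, so that \<open>nat perm \<Rightarrow>\<^sub>0 complex\<close> is the complex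
  group algebra of the finitely supported permutations of \<open>nat\<close>. This addition on permutations
  is used nowhere else.
\<close>

instantiation perm :: (type) monoid_add
begin

definition zero_perm :: "'a perm" where
  "zero_perm = 1"

definition plus_perm :: "'a perm \<Rightarrow> 'a perm \<Rightarrow> 'a perm" where
  "plus_perm p q = p * q"

instance
  by standard (simp_all add: zero_perm_def plus_perm_def mult.assoc)

end

type_synonym perm_algebra = "nat perm \<Rightarrow>\<^sub>0 complex"

text \<open>A permutation, regarded as a basis element of the group algebra.\<close>

definition elt :: "nat perm \<Rightarrow> perm_algebra" where
  "elt w = Poly_Mapping.single w 1"

definition scale :: "complex \<Rightarrow> perm_algebra \<Rightarrow> perm_algebra" (infixr \<open>\<odot>\<close> 75) where
  "c \<odot> x = Poly_Mapping.map ((*) c) x"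

lemma lookup_scale [simp]: "Poly_Mapping.lookup (c \<odot> x) w = c * Poly_Mapping.lookup x w"
  by (simp add: scale_def Poly_Mapping.map.rep_eq when_def)

lemma scale_eq: "c \<odot> x = Poly_Mapping.single 0 c * x"
proof (rule poly_mapping_eqI)
  fix w
  have "Poly_Mapping.lookup (Poly_Mapping.single 0 c * x) w
      = (\<Sum>l. (c when (0::nat perm) = l) * (\<Sum>q. (Poly_Mapping.lookup x q when w = l + q)))"
    by (simp add: times_poly_mapping.rep_eq prod_fun_def lookup_single)
  also have "\<dots> = (\<Sum>l. (c * (\<Sum>q. (Poly_Mapping.lookup x q when w = l + q))) when (0::nat perm) = l)"
    by (intro Sum_any.cong) (simp add: when_def)
  also have "\<dots> = c * Poly_Mapping.lookup x w"
    by simp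
  finally show "Poly_Mapping.lookup (c \<odot> x) w = Poly_Mapping.lookup (Poly_Mapping.single 0 c * x) w"
    by simp
qed

lemma elt_mult: "elt p * elt q = elt (p * q)"
  by (simp add: elt_def mult_single plus_perm_def)

lemma elt_one: "elt 1 = 1"
  by (simp add: elt_def single_one flip: zero_perm_def)

definition sym_group :: "nat \<Rightarrow> nat perm set" where
  "sym_group n = {w. Perm.affected w \<subseteq> {1..n}}"

text \<open>\<open>\<complex>[S\<^sub>n]\<close>, as a subalgebra of \<^typ>\<open>perm_algebra\<close>.\<close>

definition group_algebra :: "nat \<Rightarrow> perm_algebra set" where
  "group_algebra n = {x. Poly_Mapping.keys x \<subseteq> sym_group n}"

text \<open>Vectors of \<open>\<real>\<^sup>n\<close> are functions \<^typ>\<open>nat \<Rightarrow> real\<close> with coordinates indexed by \<open>{1..n}\<close>.\<close>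

definition eps :: "nat \<Rightarrow> nat \<Rightarrow> real" where
  "eps i = (\<lambda>k. if k = i then 1 else 0)"

definition root :: "nat \<Rightarrow> nat \<Rightarrow> nat \<Rightarrow> real" where
  "root i j = (\<lambda>k. eps i k - eps j k)"

definition roots :: "nat \<Rightarrow> (nat \<Rightarrow> real) set" where
  "roots n = {root i j | i j. i \<in> {1..n} \<and> j \<in> {1..n} \<and> i \<noteq> j}"

definition pos_roots :: "nat \<Rightarrow> (nat \<Rightarrow> real) set" where
  "pos_roots n = {root i j | i j. i \<in> {1..n} \<and> j \<in> {1..n} \<and> i < j}"

definition bilin :: "nat \<Rightarrow> (nat \<Rightarrow> real) \<Rightarrow> (nat \<Rightarrow> real) \<Rightarrow> real" where
  "bilin n u v = (\<Sum>k=1..n. u k * v k)"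

lemma bilin_root_self:
  assumes "\<alpha> \<in> roots n"
  shows "bilin n \<alpha> \<alpha> = 2"
proof -
  obtain i j where ij: "i \<in> {1..n}" "j \<in> {1..n}" "i \<noteq> j" "\<alpha> = root i j"
    using assms by (auto simp: roots_def)
  have "bilin n \<alpha> \<alpha> = (\<Sum>k=1..n. (if k = i then 1 else 0) + (if k = j then 1 else 0))"
    unfolding bilin_def ij(4) by (intro sum.cong) (use ij(3) in \<open>auto simp: root_def eps_def\<close>)
  then show ?thesis
    using ij(1,2) by (simp add: sum.distrib)
qed

text \<open>The linear action of permutations, with \<open>w \<cdot> \<epsilon>\<^sub>i = \<epsilon>\<^sub>w\<^sub>(\<^sub>i\<^sub>)\<close>.\<close>

definition vec_act :: "nat perm \<Rightarrow> (nat \<Rightarrow> real) \<Rightarrow> nat \<Rightarrow> real" where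
  "vec_act w v = (\<lambda>k. v (Perm.apply (inverse w) k))"

text \<open>The Weyl group element that acts as the reflection in \<open>\<alpha>\<close>.\<close>

definition reflection :: "nat \<Rightarrow> (nat \<Rightarrow> real) \<Rightarrow> nat perm" where
  "reflection n \<alpha> = (THE w. w \<in> sym_group n \<and>
     (\<forall>v. vec_act w v = (\<lambda>k. v k - 2 * bilin n v \<alpha> / bilin n \<alpha> \<alpha> * \<alpha> k)))"

lemma vec_act_eps: "vec_act w (eps i) = eps (Perm.apply w i)"
proof
  fix k
  have "Perm.apply (inverse w) k = i \<longleftrightarrow> k = Perm.apply w i"
    by (metis apply_inverse bij_apply bij_inv_eq_iff)
  then show "vec_act w (eps i) k = eps (Perm.apply w i) k"
    by (simp add: vec_act_def eps_def)
qed

lemma reflection_root: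
  assumes "i \<in> {1..n}" "j \<in> {1..n}" "i \<noteq> j"
  shows "reflection n (root i j) = Perm.swap i j"
  unfolding reflection_def
proof (rule the_equality)
  have "root i j \<in> roots n"
    using assms by (auto simp: roots_def)
  then have B: "bilin n (root i j) (root i j) = 2"
    by (rule bilin_root_self)
  have vB: "bilin n v (root i j) = v i - v j" for v
  proof -
    have "bilin n v (root i j)
        = (\<Sum>k=1..n. (if k = i then v k else 0) - (if k = j then v k else 0))"
      unfolding bilin_def by (intro sum.cong) (auto simp: root_def eps_def)
    then show ?thesis
      using assms by (simp add: sum_subtractf)
  qed
  show P: "Perm.swap i j \<in> sym_group n \<and> (\<forall>v. vec_act (Perm.swap i j) v =
      (\<lambda>k. v k - 2 * bilin n v (root i j) / bilin n (root i j) (root i j) * root i j k))"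
  proof (intro conjI allI ext)
    show "Perm.swap i j \<in> sym_group n"
      using assms by (simp add: sym_group_def affected_swap)
    fix v k
    show "vec_act (Perm.swap i j) v k
        = v k - 2 * bilin n v (root i j) / bilin n (root i j) (root i j) * root i j k"
      using assms(3) unfolding B vB
      by (cases "k = i"; cases "k = j") (auto simp: vec_act_def root_def eps_def field_simps)
  qed
  fix w
  assume w: "w \<in> sym_group n \<and> (\<forall>v. vec_act w v =
      (\<lambda>k. v k - 2 * bilin n v (root i j) / bilin n (root i j) (root i j) * root i j k))"
  show "w = Perm.swap i j"
  proof (rule perm_eqI)
    fix a
    have "vec_act w (eps a) = vec_act (Perm.swap i j) (eps a)"
      using w P by metis
    then have "eps (Perm.apply w a) = eps (Perm.apply (Perm.swap i j) a)"
      by (simp only: vec_act_eps)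
    then have "eps (Perm.apply w a) (Perm.apply w a)
        = eps (Perm.apply (Perm.swap i j) a) (Perm.apply w a)"
      by simp
    then show "Perm.apply w a = Perm.apply (Perm.swap i j) a"
      by (simp add: eps_def split: if_splits)
  qed
qed

definition Omega :: "nat \<Rightarrow> perm_algebra" where
  "Omega n = (1/4) \<odot> (\<Sum>\<alpha>\<in>pos_roots n. \<Sum>\<beta>\<in>pos_roots n.
     of_real (bilin n \<alpha> \<beta>) \<odot> (elt (reflection n \<alpha>) * elt (reflection n \<beta>)))"

definition three_cycles :: "nat \<Rightarrow> nat perm set" where
  "three_cycles n = {Perm.cycle [a, b, c] | a b c. {a, b, c} \<subseteq> {1..n} \<and> distinct [a, b, c]}"

definition e123 :: "nat \<Rightarrow> perm_algebra" where
  "e123 n = (\<Sum>w\<in>three_cycles n. elt w)"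

definition jucys_murphy :: "nat \<Rightarrow> perm_algebra" where
  "jucys_murphy i = (\<Sum>j\<in>{1..<i}. elt (Perm.swap j i))"

definition partition_of :: "nat list \<Rightarrow> nat \<Rightarrow> bool" where
  "partition_of lam n \<longleftrightarrow> sorted_wrt (\<ge>) lam \<and> 0 \<notin> set lam \<and> sum_list lam = n"

text \<open>Boxes are pairs \<open>(row, column)\<close>, both counted from 1.\<close>

definition diagram :: "nat list \<Rightarrow> (nat \<times> nat) set" where
  "diagram lam = {(r, c). r \<in> {1..length lam} \<and> c \<in> {1..lam ! (r - 1)}}"

definition content :: "nat \<times> nat \<Rightarrow> int" where
  "content b = int (snd b) - int (fst b)"

definition content_power_sum :: "nat \<Rightarrow> nat list \<Rightarrow> int" where
  "content_power_sum k lam = (\<Sum>b\<in>diagram lam. content b ^ k)"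

text \<open>Bijective numberings of the diagram; they need not be standard.\<close>

definition tableau :: "nat \<Rightarrow> nat list \<Rightarrow> (nat \<times> nat \<Rightarrow> nat) \<Rightarrow> bool" where
  "tableau n lam t \<longleftrightarrow> bij_betw t (diagram lam) {1..n}"

definition row_stabilizer :: "nat \<Rightarrow> nat list \<Rightarrow> (nat \<times> nat \<Rightarrow> nat) \<Rightarrow> nat perm set" where
  "row_stabilizer n lam t = {w \<in> sym_group n. \<forall>r.
     Perm.apply w ` t ` {b \<in> diagram lam. fst b = r} = t ` {b \<in> diagram lam. fst b = r}}"

definition col_stabilizer :: "nat \<Rightarrow> nat list \<Rightarrow> (nat \<times> nat \<Rightarrow> nat) \<Rightarrow> nat perm set" where
  "col_stabilizer n lam t = {w \<in> sym_group n. \<forall>c.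
     Perm.apply w ` t ` {b \<in> diagram lam. snd b = c} = t ` {b \<in> diagram lam. snd b = c}}"

definition young_symmetrizer :: "nat \<Rightarrow> nat list \<Rightarrow> (nat \<times> nat \<Rightarrow> nat) \<Rightarrow> perm_algebra" where
  "young_symmetrizer n lam t =
     (\<Sum>p\<in>row_stabilizer n lam t. elt p) *
     (\<Sum>q\<in>col_stabilizer n lam t. of_int (sign (Perm.apply q)) \<odot> elt q)"

text \<open>
  The irreducible representation attached to \<open>lam\<close>, realised as the left ideal of \<open>\<complex>[S\<^sub>n]\<close> generated by
  the Young symmetrizer (so that the one-row partition gives the trivial representation);
  \<open>\<complex>[S\<^sub>n]\<close> acts by left multiplication. Different tableaux of the same shape
  give isomorphic representations.
\<close>

definition irrep :: "nat \<Rightarrow> nat list \<Rightarrow> (nat \<times> nat \<Rightarrow> nat) \<Rightarrow> perm_algebra set" where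
  "irrep n lam t = {x * young_symmetrizer n lam t | x. x \<in> group_algebra n}"

lemma finite_sym_group: "finite (sym_group n)"
proof -
  have "Perm.apply ` sym_group n \<subseteq> {p. p permutes {1..n}}"
  proof
    fix f assume "f \<in> Perm.apply ` sym_group n"
    then obtain w where w: "w \<in> sym_group n" "f = Perm.apply w" by blast
    have "x \<notin> {1..n} \<Longrightarrow> Perm.apply w x = x" for x
      using w(1) in_affected[of x w] by (auto simp: sym_group_def)
    then show "f \<in> {p. p permutes {1..n}}"
      unfolding w(2) permutes_def using bij_apply[of w] by (simp add: bij_iff)
  qed
  then have "finite (Perm.apply ` sym_group n)"
    by (rule finite_subset) (simp add: finite_permutations)
  then show ?thesis
    by (rule finite_imageD) (simp add: inj_on_def apply_inject)
qed

lemma exists_tableau: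
  assumes "partition_of lam n"
  shows "\<exists>t. tableau n lam t"
proof -
  have D: "diagram lam = (SIGMA r:{1..length lam}. {1..lam ! (r - 1)})"
    by (auto simp: diagram_def)
  have "card (diagram lam) = (\<Sum>r=1..length lam. lam ! (r - 1))"
    unfolding D by (subst card_SigmaI) auto
  also have "\<dots> = (\<Sum>r<length lam. lam ! r)"
    by (rule sum.reindex_bij_witness[of _ Suc "\<lambda>r. r - 1"]) auto
  also have "\<dots> = n"
    using assms by (simp add: partition_of_def sum_list_sum_nth atLeast0LessThan)
  finally have "card (diagram lam) = card {1..n}" by simp
  moreover have "finite (diagram lam)"
    unfolding D by simp
  ultimately show ?thesis
    unfolding tableau_def by (intro finite_same_card_bij) auto
qed

lemma stabilizers_trivial_product:
  assumes t: "tableau n lam t" and p: "p \<in> row_stabilizer n lam t" and q: "q \<in> col_stabilizer n lam t"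
    and pq: "p * q = 1"
  shows "p = 1 \<and> q = 1"
proof -
  have "Perm.apply q a = a" for a
  proof (cases "a \<in> {1..n}")
    case False
    then show ?thesis
      using q in_affected[of a q] by (auto simp: col_stabilizer_def sym_group_def)
  next
    case True
    then have "a \<in> t ` diagram lam"
      using t by (simp add: tableau_def bij_betw_def)
    then obtain b where b: "b \<in> diagram lam" "a = t b"
      by blast
    have "Perm.apply q (t b) \<in> Perm.apply q ` t ` {b' \<in> diagram lam. snd b' = snd b}"
      using b by blast
    also have "\<dots> = t ` {b' \<in> diagram lam. snd b' = snd b}"
      using q by (simp add: col_stabilizer_def)
    finally obtain b' where b': "b' \<in> diagram lam" "snd b' = snd b" "Perm.apply q (t b) = t b'"
      by blast
    have "Perm.apply p (t b') \<in> Perm.apply p ` t ` {x \<in> diagram lam. fst x = fst b'}"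
      using b' by blast
    also have "\<dots> = t ` {x \<in> diagram lam. fst x = fst b'}"
      using p by (simp add: row_stabilizer_def)
    finally obtain x where x: "x \<in> diagram lam" "fst x = fst b'" "Perm.apply p (t b') = t x"
      by blast
    have "t x = t b"
      using x(3) b'(3) pq by (metis apply_sequence apply_one id_apply)
    then have "x = b"
      using t x(1) b(1) by (auto simp: tableau_def bij_betw_def inj_on_def)
    then have "b' = b"
      using x b' by (simp add: prod_eq_iff)
    then show ?thesis
      using b b' by simp
  qed
  then have "q = 1"
    by (intro perm_eqI) simp
  then show ?thesis
    using pq by simp
qed

lemma one_in_stabilizers: "1 \<in> row_stabilizer n lam t" "1 \<in> col_stabilizer n lam t"
  by (simp_all add: row_stabilizer_def col_stabilizer_def sym_group_def)

lemma finite_stabilizers: "finite (row_stabilizer n lam t)" "finite (col_stabilizer n lam t)"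
  by (auto intro: finite_subset[OF _ finite_sym_group[of n]]
      simp: row_stabilizer_def col_stabilizer_def)

lemma lookup_young_symmetrizer_one:
  assumes t: "tableau n lam t"
  shows "Poly_Mapping.lookup (young_symmetrizer n lam t) 1 = 1"
proof -
  let ?R = "row_stabilizer n lam t" and ?C = "col_stabilizer n lam t"
  have scale_elt: "c \<odot> elt q = Poly_Mapping.single q c" for c q
    by (rule poly_mapping_eqI) (simp add: elt_def lookup_single when_def)
  have mult: "elt p * (c \<odot> elt q) = Poly_Mapping.single (p * q) c" for c p q
    unfolding scale_elt by (simp add: elt_def mult_single plus_perm_def)
  have "young_symmetrizer n lam t
      = (\<Sum>p\<in>?R. \<Sum>q\<in>?C. Poly_Mapping.single (p * q) (of_int (sign (Perm.apply q))))"
    by (simp add: young_symmetrizer_def sum_product mult)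
  then have "Poly_Mapping.lookup (young_symmetrizer n lam t) 1
      = (\<Sum>p\<in>?R. \<Sum>q\<in>?C. of_int (sign (Perm.apply q)) when p * q = 1)"
    by (simp add: lookup_sum lookup_single)
  also have "\<dots> = (\<Sum>p\<in>?R. \<Sum>q\<in>?C. if q = 1 then (if p = 1 then 1 else 0) else 0)"
    using stabilizers_trivial_product[OF t]
    by (intro sum.cong refl) (fastforce simp: when_def)
  also have "\<dots> = 1"
    by (simp add: finite_stabilizers one_in_stabilizers)
  finally show ?thesis .
qed

lemma irrep_nonzero:
  assumes "tableau n lam t"
  shows "irrep n lam t \<noteq> {0}"
proof -
  have "1 \<in> group_algebra n"
    by (simp add: group_algebra_def sym_group_def zero_perm_def flip: single_one)
  then have "young_symmetrizer n lam t \<in> irrep n lam t"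
    unfolding irrep_def by (metis (mono_tags, lifting) mem_Collect_eq mult_1)
  moreover have "young_symmetrizer n lam t \<noteq> 0"
    using lookup_young_symmetrizer_one[OF assms] by auto
  ultimately show ?thesis by auto
qed

end

theory Submission
  imports Defs
begin

text \<open>
  Expanding \<open>B(\<alpha>, \<beta>) = \<Sum>\<^sub>m \<alpha>\<^sub>m \<beta>\<^sub>m\<close> gives \<open>4 \<Omega> = \<Sum>\<^sub>m (U\<^sub>m - T\<^sub>m)\<^sup>2\<close>, where \<open>T\<^sub>m\<close> and \<open>U\<^sub>m\<close> are
  the sums of the transpositions \<open>(x, m)\<close> with \<open>x < m\<close> and \<open>x > m\<close>. A \<open>3\<close>-cycle can be written as
  \<open>(x, z)(y, z)\<close> in three ways that differ by a rotation of \<open>(x, y, z)\<close>. Choosing the way in which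
  \<open>z\<close> is maximal, minimal or in the middle yields \<open>\<Sum> T\<^sub>m\<^sup>2 = \<Sum> U\<^sub>m\<^sup>2 = n(n-1)/2 + e\<^bsub>(123)\<^esub>\<close> and
  \<open>\<Sum> (T\<^sub>m U\<^sub>m + U\<^sub>m T\<^sub>m) = e\<^bsub>(123)\<^esub>\<close>, hence (a) and (b).

  The formula for \<open>\<Sum> T\<^sub>m\<^sup>2\<close> holds for every strict linear order, so for (c) the boxes of the diagram
  are ordered row by row. With \<open>a\<close> the row sum and \<open>b\<close> the signed column sum of the tableau, one
  gets \<open>a T\<^sub>z\<^sup>2 b = (content z)\<^sup>2 a b\<close> for each box \<open>z\<close>, because \<open>a g b = 0\<close> whenever the permutation \<open>g\<close>
  sends two entries of a column into one row. Since \<open>e\<^bsub>(123)\<^esub>\<close> is central, this determines its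
  action on the left ideal generated by \<open>a b\<close>.
\<close>

subsection \<open>Sums of squares of Jucys-Murphy elements\<close>

lemma apply_swap: "Perm.apply (Perm.swap a b) c = (if c = a then b else if c = b then a else c)"
  by auto

text \<open>Both sides are the cycle a -> c -> b -> a, which depends on (a, b, c) only up to
  rotation.\<close>

lemma swap_mult_swap_rotate:
  assumes "distinct [a, b, c]"
  shows "Perm.swap a c * Perm.swap b c = Perm.swap b a * Perm.swap c a"
  using assms by (intro perm_eqI) (auto simp: apply_times apply_swap)

text \<open>Moving one transposition past the other conjugates it. This later brings a transposition
  of two boxes in one row next to \<open>rowsum\<close>, which absorbs it.\<close>

lemma swap_mult_swap_factors:
  assumes "distinct [a, b, c]"
  shows "Perm.swap a c * Perm.swap b c = Perm.swap b c * Perm.swap a b"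
    and "Perm.swap a c * Perm.swap b c = Perm.swap a b * Perm.swap a c"
  using assms by (auto intro!: perm_eqI simp: apply_times apply_swap)

text \<open>A 3-cycle determines its triple up to rotation: the moved point a' must be one of a, b,
  c, and c', b' are then its successive images.\<close>

lemma swap_mult_swap_eqD:
  assumes "distinct [a, b, c]" "distinct [a', b', c']"
    and eq: "Perm.swap a c * Perm.swap b c = Perm.swap a' c' * Perm.swap b' c'"
  shows "(a', b', c') \<in> {(a, b, c), (b, c, a), (c, a, b)}"
proof -
  let ?w = "Perm.swap a c * Perm.swap b c"
  have w: "Perm.apply ?w x = (if x = a then c else if x = c then b else if x = b then a else x)" for x
    using assms(1) by (auto simp: apply_times apply_swap)
  have "Perm.apply ?w a' = c'" "Perm.apply ?w c' = b'"
    unfolding eq using assms(2) by (auto simp: apply_times apply_swap)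
  moreover from this(1) have "a' \<in> {a, b, c}"
    using assms(2) w[of a'] by (simp split: if_splits)
  ultimately show ?thesis
    using assms(1) w[of a] w[of b] w[of c] by (elim insertE emptyE) auto
qed

lemma three_cycles_eq:
  "three_cycles n =
     {Perm.swap a c * Perm.swap b c | a b c. {a, b, c} \<subseteq> {1..n} \<and> distinct [a, b, c]}"
proof -
  \<comment> \<open>\<open>Perm.cycle [a, b, c]\<close> sends a to b, while (a c)(b c) sends a to c;
    the two descriptions therefore exchange a and b, as do the witnesses below.\<close>
  have *: "Perm.cycle [a, b, c] = Perm.swap b c * Perm.swap a c" if "distinct [a, b, c]" for a b c :: nat
    using that by (intro perm_eqI) (auto simp: apply_times apply_swap)
  show ?thesis
  proof (intro set_eqI iffI)
    fix w assume "w \<in> three_cycles n"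
    then obtain a b c where "w = Perm.cycle [a, b, c]" "{a, b, c} \<subseteq> {1..n}" "distinct [a, b, c]"
      unfolding three_cycles_def by blast
    then show "w \<in> {Perm.swap a c * Perm.swap b c | a b c. {a, b, c} \<subseteq> {1..n} \<and> distinct [a, b, c]}"
      unfolding mem_Collect_eq by (intro exI[of _ b] exI[of _ a] exI[of _ c]) (use * in auto)
  next
    fix w assume "w \<in> {Perm.swap a c * Perm.swap b c | a b c. {a, b, c} \<subseteq> {1..n} \<and> distinct [a, b, c]}"
    then obtain a b c where w: "w = Perm.swap a c * Perm.swap b c" "{a, b, c} \<subseteq> {1..n}" "distinct [a, b, c]"
      by blast
    then have "w = Perm.cycle [b, a, c]"
      using *[of b a c] by simp
    then show "w \<in> three_cycles n"
      unfolding three_cycles_def mem_Collect_eq using w(2,3)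
      by (intro exI[of _ b] exI[of _ a] exI[of _ c]) auto
  qed
qed

text \<open>\<open>R\<close> selects exactly one of the three rotations of each triple, hence one
  factorisation of each 3-cycle. The numbering \<open>t\<close> is arbitrary so that the lemma
  serves the identity, a permutation of {1..n} and a tableau alike.\<close>

lemma e123_eq_sum_oriented:
  fixes t :: "'a \<Rightarrow> nat"
  assumes t: "bij_betw t D {1..n}"
    and R: "\<And>x y z. \<lbrakk>x \<in> D; y \<in> D; z \<in> D; distinct [x, y, z]\<rbrakk> \<Longrightarrow>
      (R x y z \<and> \<not> R y z x \<and> \<not> R z x y) \<or> (\<not> R x y z \<and> R y z x \<and> \<not> R z x y) \<or>
      (\<not> R x y z \<and> \<not> R y z x \<and> R z x y)"
  shows "e123 n = (\<Sum>(x, y, z) \<in> {(x, y, z) \<in> D \<times> D \<times> D. distinct [x, y, z] \<and> R x y z}.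
    elt (Perm.swap (t x) (t z)) * elt (Perm.swap (t y) (t z)))"
proof -
  let ?S = "{(x, y, z) \<in> D \<times> D \<times> D. distinct [x, y, z] \<and> R x y z}"
  let ?f = "\<lambda>(x, y, z). Perm.swap (t x) (t z) * Perm.swap (t y) (t z)"
  have inj_t: "t x = t y \<longleftrightarrow> x = y" if "x \<in> D" "y \<in> D" for x y
    using t that by (auto simp: bij_betw_def inj_on_def)
  have img: "t ` D = {1..n}"
    using t by (simp add: bij_betw_def)
  have "inj_on ?f ?S"
  proof (intro inj_onI)
    fix u v assume u: "u \<in> ?S" and v: "v \<in> ?S" and eq: "?f u = ?f v"
    obtain x y z where u': "u = (x, y, z)" by (rule prod_cases3)
    obtain x' y' z' where v': "v = (x', y', z')" by (rule prod_cases3)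
    note uv = u' v'
    have "distinct [t x, t y, t z]" "distinct [t x', t y', t z']"
      using u v by (auto simp: uv inj_t)
    moreover have "Perm.swap (t x) (t z) * Perm.swap (t y) (t z) =
        Perm.swap (t x') (t z') * Perm.swap (t y') (t z')"
      using eq by (simp add: uv)
    ultimately have "(t x', t y', t z') \<in> {(t x, t y, t z), (t y, t z, t x), (t z, t x, t y)}"
      by (rule swap_mult_swap_eqD)
    then have "(x', y', z') \<in> {(x, y, z), (y, z, x), (z, x, y)}"
      using u v by (auto simp: uv inj_t)
    then show "u = v"
      using u v R[of x y z] by (auto simp: uv)
  qed
  moreover have "?f ` ?S = three_cycles n"
  proof
    show "?f ` ?S \<subseteq> three_cycles n"
    proof
      fix w assume "w \<in> ?f ` ?S"
      then obtain x y z where "x \<in> D" "y \<in> D" "z \<in> D" "distinct [x, y, z]"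
        and w: "w = Perm.swap (t x) (t z) * Perm.swap (t y) (t z)"
        by auto
      then have "{t x, t y, t z} \<subseteq> {1..n}" "distinct [t x, t y, t z]"
        unfolding img[symmetric] by (auto simp: inj_t)
      then show "w \<in> three_cycles n"
        unfolding three_cycles_eq mem_Collect_eq w by blast
    qed
    show "three_cycles n \<subseteq> ?f ` ?S"
    proof
      fix w assume "w \<in> three_cycles n"
      then obtain a b c where abc: "{a, b, c} \<subseteq> {1..n}" "distinct [a, b, c]"
        and w: "w = Perm.swap a c * Perm.swap b c"
        by (auto simp: three_cycles_eq)
      have "a \<in> t ` D" "b \<in> t ` D" "c \<in> t ` D"
        using abc(1) img by simp_all
      then obtain x y z where xyz: "x \<in> D" "y \<in> D" "z \<in> D" "a = t x" "b = t y" "c = t z"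
        by (elim imageE)
      have d: "distinct [x, y, z]"
        using abc(2) xyz by auto
      have eq: "w = ?f (x, y, z)" "w = ?f (y, z, x)" "w = ?f (z, x, y)"
        using swap_mult_swap_rotate[OF abc(2)] swap_mult_swap_rotate[of b c a] abc(2) w xyz
        by simp_all
      have "(x, y, z) \<in> ?S \<or> (y, z, x) \<in> ?S \<or> (z, x, y) \<in> ?S"
        using R[OF xyz(1-3) d] d xyz by auto
      then show "w \<in> ?f ` ?S"
        by (elim disjE) (rule image_eqI, (rule eq)?, assumption)+
    qed
  qed
  ultimately have "bij_betw ?f ?S (three_cycles n)"
    by (simp add: bij_betw_def)
  then have "e123 n = (\<Sum>u\<in>?S. elt (?f u))"
    unfolding e123_def by (simp only: sum.reindex_bij_betw)
  then show ?thesis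
    by (simp add: elt_mult case_prod_unfold)
qed

text \<open>The off-diagonal pairs split into two halves that are exchanged by swapping
  coordinates.\<close>

lemma card_strict_linear_pairs:
  assumes "finite D"
    and total: "\<And>x y. \<lbrakk>x \<in> D; y \<in> D; x \<noteq> y\<rbrakk> \<Longrightarrow> L x y \<noteq> L y x"
    and irrefl: "\<And>x. \<not> L x x"
  shows "card {(x, y) \<in> D \<times> D. L x y} = card D choose 2"
proof -
  let ?A = "{(x, y) \<in> D \<times> D. L x y}" and ?B = "{(x, y) \<in> D \<times> D. L y x}"
  have fin: "finite ?A" "finite ?B"
    using assms(1) by (auto intro: finite_subset[of _ "D \<times> D"])
  have "D \<times> D - Id_on D = ?A \<union> ?B"
    using total irrefl by blast
  moreover have "?A \<inter> ?B = {}"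
    using total irrefl by blast
  ultimately have "card (D \<times> D - Id_on D) = card ?A + card ?B"
    using fin by (simp add: card_Un_disjoint)
  moreover have "card (D \<times> D - Id_on D) = card D * card D - card D"
  proof -
    have "Id_on D = (\<lambda>x. (x, x)) ` D" by (auto simp: Id_on_def)
    then have "card (Id_on D) = card D" "finite (Id_on D)"
      using assms(1) by (auto simp: card_image inj_on_def)
    moreover have "Id_on D \<subseteq> D \<times> D" by auto
    ultimately show ?thesis
      by (simp add: card_Diff_subset card_cartesian_product)
  qed
  moreover have "card ?B = card ?A"
    by (rule bij_betw_same_card[of prod.swap]) (auto simp: bij_betw_def inj_on_def)
  ultimately show ?thesis
    by (simp add: choose_two diff_mult_distrib2)
qed

text \<open>In each square the diagonal terms are squares of transpositions, hence 1, and are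
  counted by the pairs with \<open>L x z\<close>. The remaining terms are the 3-cycles, factored
  with the \<open>L\<close>-maximum in last place.\<close>

lemma sum_jucys_murphy_squares:
  fixes t :: "'a \<Rightarrow> nat"
  assumes t: "bij_betw t D {1..n}"
    and total: "\<And>x y. \<lbrakk>x \<in> D; y \<in> D; x \<noteq> y\<rbrakk> \<Longrightarrow> L x y \<noteq> L y x"
    and irrefl: "\<And>x. \<not> L x x"
    and trans: "\<And>x y z. L x y \<Longrightarrow> L y z \<Longrightarrow> L x z"
  shows "(\<Sum>z\<in>D. (\<Sum>x | x \<in> D \<and> L x z. elt (Perm.swap (t x) (t z)))\<^sup>2)
    = of_nat (n choose 2) + e123 n"
proof -
  let ?s = "\<lambda>x z. elt (Perm.swap (t x) (t z))"
  have D: "finite D" "card D = n"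
    using t bij_betw_finite bij_betw_same_card by fastforce+
  have split: "(\<Sum>x | x \<in> D \<and> L x z. ?s x z)\<^sup>2 = of_nat (card {x \<in> D. L x z}) +
      (\<Sum>(x, y) | x \<in> D \<and> y \<in> D \<and> x \<noteq> y \<and> L x z \<and> L y z. ?s x z * ?s y z)" for z
  proof -
    let ?A = "{x \<in> D. L x z}"
    have "(\<Sum>x\<in>?A. ?s x z)\<^sup>2 = (\<Sum>(x, y)\<in>?A \<times> ?A. ?s x z * ?s y z)"
      by (simp add: power2_eq_square sum_product sum.cartesian_product)
    also have "?A \<times> ?A = (\<lambda>x. (x, x)) ` ?A \<union>
        {(x, y). x \<in> D \<and> y \<in> D \<and> x \<noteq> y \<and> L x z \<and> L y z}"
      by auto
    also have "(\<Sum>(x, y)\<in>\<dots>. ?s x z * ?s y z) = (\<Sum>(x, y)\<in>(\<lambda>x. (x, x)) ` ?A. ?s x z * ?s y z)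
        + (\<Sum>(x, y) | x \<in> D \<and> y \<in> D \<and> x \<noteq> y \<and> L x z \<and> L y z. ?s x z * ?s y z)"
      by (rule sum.union_disjoint) (use D in \<open>auto intro: finite_subset[of _ "D \<times> D"]\<close>)
    also have "(\<Sum>(x, y)\<in>(\<lambda>x. (x, x)) ` ?A. ?s x z * ?s y z) = of_nat (card ?A)"
      by (subst sum.reindex) (auto simp: inj_on_def elt_mult elt_one)
    finally show ?thesis .
  qed
  have "(\<Sum>z\<in>D. of_nat (card {x \<in> D. L x z})) = (of_nat (n choose 2) :: perm_algebra)"
  proof -
    have "(\<Sum>z\<in>D. card {x \<in> D. L x z}) = card (SIGMA z:D. {x \<in> D. L x z})"
      using D by simp
    also have "\<dots> = card {(x, z) \<in> D \<times> D. L x z}"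
      by (rule bij_betw_same_card[of prod.swap]) (auto simp: bij_betw_def inj_on_def)
    also have "\<dots> = n choose 2"
      using card_strict_linear_pairs[OF D(1), of L] total irrefl D(2) by simp
    finally show ?thesis by (simp flip: of_nat_sum)
  qed
  moreover have "(\<Sum>z\<in>D. \<Sum>(x, y) | x \<in> D \<and> y \<in> D \<and> x \<noteq> y \<and> L x z \<and> L y z. ?s x z * ?s y z)
      = e123 n"
  proof -
    have "e123 n = (\<Sum>(x, y, z) \<in> {(x, y, z) \<in> D \<times> D \<times> D. distinct [x, y, z] \<and> L x z \<and> L y z}.
        ?s x z * ?s y z)"
    proof (rule e123_eq_sum_oriented[OF t, where R = "\<lambda>x y z. L x z \<and> L y z"])
      fix x y z assume *: "x \<in> D" "y \<in> D" "z \<in> D" "distinct [x, y, z]"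
      have "L x y \<noteq> L y x" "L y z \<noteq> L z y" "L z x \<noteq> L x z"
        using * total by auto
      \<comment> \<open>Three comparisons have eight outcomes. Transitivity excludes the two cyclic
        ones; in the other six exactly one element is the maximum.\<close>
      moreover have "L x y \<Longrightarrow> L y z \<Longrightarrow> L x z" "L y z \<Longrightarrow> L z x \<Longrightarrow> L y x"
        "L z x \<Longrightarrow> L x y \<Longrightarrow> L z y" "L z y \<Longrightarrow> L y x \<Longrightarrow> L z x" by (blast intro: trans)+
      ultimately show "((L x z \<and> L y z) \<and> \<not> (L y x \<and> L z x) \<and> \<not> (L z y \<and> L x y)) \<or>
          (\<not> (L x z \<and> L y z) \<and> (L y x \<and> L z x) \<and> \<not> (L z y \<and> L x y)) \<or>
          (\<not> (L x z \<and> L y z) \<and> \<not> (L y x \<and> L z x) \<and> (L z y \<and> L x y))"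
        by (cases "L x y"; cases "L y z"; cases "L z x"; simp)
    qed
    also have "\<dots> = (\<Sum>(z, x, y) \<in> (SIGMA z:D. {(x, y). x \<in> D \<and> y \<in> D \<and> x \<noteq> y \<and> L x z \<and> L y z}).
        ?s x z * ?s y z)"
      by (rule sum.reindex_bij_witness[of _ "\<lambda>(z, x, y). (x, y, z)" "\<lambda>(x, y, z). (z, x, y)"])
        (use irrefl in auto)
    also have "\<dots> = (\<Sum>z\<in>D. \<Sum>(x, y) | x \<in> D \<and> y \<in> D \<and> x \<noteq> y \<and> L x z \<and> L y z. ?s x z * ?s y z)"
      by (subst sum.Sigma) (use D in \<open>auto intro: finite_subset[of _ "D \<times> D"]\<close>)
    finally show ?thesis by simp
  qed
  ultimately show ?thesis
    by (simp add: split sum.distrib)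
qed

subsection \<open>Omega as a central element\<close>

lemma scale_of_int: "of_int k \<odot> x = of_int k * x"
  by (simp add: scale_eq)

lemma elt_mult_scale: "elt p * (c \<odot> x) = c \<odot> (elt p * x)"
proof -
  have "elt p * Poly_Mapping.single 0 c = Poly_Mapping.single 0 c * elt p"
    by (simp add: elt_def mult_single)
  then show ?thesis
    by (simp add: scale_eq flip: mult.assoc)
qed

lemma poly_mapping_eq_sum_single:
  "x = (\<Sum>w\<in>Poly_Mapping.keys x. Poly_Mapping.single w (Poly_Mapping.lookup x w))"
  by (rule poly_mapping_eqI) (simp add: lookup_sum lookup_single when_def in_keys_iff)

lemma mult_swap: "w * Perm.swap a b = Perm.swap (Perm.apply w a) (Perm.apply w b) * w"
  by (rule perm_eqI) (auto simp: apply_times apply_swap apply_inj)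

lemma bij_betw_apply_sym_group:
  assumes "w \<in> sym_group n"
  shows "bij_betw (Perm.apply w) {1..n} {1..n}"
proof -
  have "Perm.apply w x \<in> {1..n}" if "x \<in> {1..n}" for x
  proof (cases "x \<in> Perm.affected w")
    case True
    then have "Perm.apply w x \<in> Perm.affected w" by simp
    then show ?thesis
      using assms unfolding sym_group_def by blast
  qed (use that in \<open>simp add: in_affected\<close>)
  then show ?thesis
    unfolding bij_betw_def
    by (intro conjI endo_inj_surj) (auto simp: inj_on_def apply_inj)
qed

text \<open>Conjugation by w turns the expansion of \<open>e123\<close> for the numbering
  \<open>id\<close> into the one for the numbering \<open>Perm.apply w\<close>, and both have the
  same sum.\<close>

lemma elt_commutes_e123:
  assumes "w \<in> sym_group n"
  shows "elt w * e123 n = e123 n * elt w"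
proof -
  let ?R = "\<lambda>x y z. x < z \<and> y < (z::nat)"
  let ?S = "{(x, y, z) \<in> {1..n} \<times> {1..n} \<times> {1..n}. distinct [x, y, z] \<and> ?R x y z}"
  have swap: "elt w * elt (Perm.swap x y) =
      elt (Perm.swap (Perm.apply w x) (Perm.apply w y)) * elt w" for x y
    by (simp add: elt_mult mult_swap[of w])
  have "e123 n = (\<Sum>(x, y, z)\<in>?S. elt (Perm.swap (id x) (id z)) * elt (Perm.swap (id y) (id z)))"
    by (rule e123_eq_sum_oriented[where R = ?R]) (auto simp: bij_betw_def)
  then have "elt w * e123 n = (\<Sum>(x, y, z)\<in>?S.
      elt (Perm.swap (Perm.apply w x) (Perm.apply w z)) *
      elt (Perm.swap (Perm.apply w y) (Perm.apply w z)) * elt w)"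
    by (simp add: sum_distrib_left case_prod_unfold swap mult.assoc flip: mult.assoc[of "elt w"])
  also have "\<dots> = e123 n * elt w"
    by (subst e123_eq_sum_oriented[OF bij_betw_apply_sym_group[OF assms], where R = ?R])
      (auto simp: sum_distrib_right case_prod_unfold)
  finally show ?thesis .
qed

lemma group_algebra_commutes_e123:
  assumes "x \<in> group_algebra n"
  shows "x * e123 n = e123 n * x"
proof -
  have "Poly_Mapping.single w c * e123 n = e123 n * Poly_Mapping.single w c" if "w \<in> sym_group n" for w c
  proof -
    have w: "Poly_Mapping.single w c = Poly_Mapping.single 0 c * elt w"
      "Poly_Mapping.single w c = elt w * Poly_Mapping.single 0 c"
      by (simp_all add: elt_def mult_single)
    have "Poly_Mapping.single 0 c * e123 n = e123 n * Poly_Mapping.single 0 c"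
      unfolding e123_def sum_distrib_left sum_distrib_right
      by (simp add: elt_def mult_single)
    then show ?thesis
      using elt_commutes_e123[OF that] w by (metis mult.assoc)
  qed
  moreover have "Poly_Mapping.keys x \<subseteq> sym_group n"
    using assms by (simp add: group_algebra_def)
  ultimately show ?thesis
    by (subst (1 2) poly_mapping_eq_sum_single[of x])
      (auto simp: sum_distrib_left sum_distrib_right intro!: sum.cong)
qed

section \<open>Coordinate expansion of Omega and its value in terms of 3-cycles\<close>

lemma root_eq_iff:
  assumes "i \<noteq> j" "k \<noteq> l"
  shows "root i j = root k l \<longleftrightarrow> i = k \<and> j = l"
proof
  assume "root i j = root k l"
  then have "root i j i = root k l i" "root i j j = root k l j"
    by simp_all
  then show "i = k \<and> j = l"
    using assms by (auto simp: root_def eps_def split: if_splits)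
qed simp

lemma Omega_eq_sum_squares:
  "Omega n = (1/4) \<odot> (\<Sum>m=1..n.
     ((\<Sum>x | x \<in> {1..n} \<and> m < x. elt (Perm.swap x m)) -
      (\<Sum>x | x \<in> {1..n} \<and> x < m. elt (Perm.swap x m)))\<^sup>2)"
proof -
  let ?s = "\<lambda>x y. elt (Perm.swap x y)"
  let ?P = "{(i, j) \<in> {1..n} \<times> {1..n}. i < j}"
  let ?h = "\<lambda>m \<alpha>. of_real (\<alpha> m) \<odot> elt (reflection n \<alpha>)"
  have fin: "finite ?P"
    by (rule finite_subset[of _ "{1..n} \<times> {1..n}"]) auto
  have pos: "pos_roots n = (\<lambda>(i, j). root i j) ` ?P"
    by (auto simp: pos_roots_def)
  have inj: "inj_on (\<lambda>(i, j). root i j) ?P"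
    by (auto simp: inj_on_def root_eq_iff)
  \<comment> \<open>For i < j, \<open>root i j\<close> has coordinate 1 at i and -1 at j. So a
    transposition of m with x enters with sign + if x > m and - if x < m.\<close>
  have "(\<Sum>\<alpha>\<in>pos_roots n. ?h m \<alpha>) =
      (\<Sum>x | x \<in> {1..n} \<and> m < x. ?s x m) - (\<Sum>x | x \<in> {1..n} \<and> x < m. ?s x m)"
    if m: "m \<in> {1..n}" for m
  proof -
    have "(\<Sum>\<alpha>\<in>pos_roots n. ?h m \<alpha>) = (\<Sum>(i, j)\<in>?P. of_int (of_bool (m = i) - of_bool (m = j)) * ?s i j)"
    proof -
      have "?h m (root i j) = of_int (of_bool (m = i) - of_bool (m = j)) * ?s i j"
        if "(i, j) \<in> ?P" for i j
      proof -
        have "complex_of_real (root i j m) = of_int (of_bool (m = i) - of_bool (m = j))"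
          by (simp add: root_def eps_def)
        then show ?thesis
          using that by (simp only: scale_of_int) (simp add: reflection_root)
      qed
      then show ?thesis
        unfolding pos by (subst sum.reindex[OF inj]) (auto intro!: sum.cong)
    qed
    also have "\<dots> = (\<Sum>(i, j)\<in>?P. of_bool (m = i) * ?s i j) - (\<Sum>(i, j)\<in>?P. of_bool (m = j) * ?s i j)"
      by (simp add: sum_subtractf[symmetric] case_prod_unfold left_diff_distrib)
    also have "(\<Sum>(i, j)\<in>?P. of_bool (m = i) * ?s i j) = (\<Sum>(i, j) | (i, j) \<in> ?P \<and> m = i. ?s i j)"
      by (rule sum.mono_neutral_cong_right) (use fin in \<open>auto simp: of_bool_def split: if_splits\<close>)
    also have "\<dots> = (\<Sum>x | x \<in> {1..n} \<and> m < x. ?s x m)"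
      by (rule sum.reindex_bij_witness[of _ "\<lambda>x. (m, x)" snd]) (use m in \<open>auto simp: swap_sym\<close>)
    also have "(\<Sum>(i, j)\<in>?P. of_bool (m = j) * ?s i j) = (\<Sum>(i, j) | (i, j) \<in> ?P \<and> m = j. ?s i j)"
      by (rule sum.mono_neutral_cong_right) (use fin in \<open>auto simp: of_bool_def split: if_splits\<close>)
    also have "\<dots> = (\<Sum>x | x \<in> {1..n} \<and> x < m. ?s x m)"
      by (rule sum.reindex_bij_witness[of _ "\<lambda>x. (x, m)" fst]) (use m in \<open>auto simp: swap_sym\<close>)
    finally show ?thesis .
  qed
  \<comment> \<open>Each summand of the bilinear form is a product of coordinates, so for fixed m
    the double sum over roots factors into a square.\<close>
  moreover have "(\<Sum>\<alpha>\<in>pos_roots n. \<Sum>\<beta>\<in>pos_roots n.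
      of_real (bilin n \<alpha> \<beta>) \<odot> (elt (reflection n \<alpha>) * elt (reflection n \<beta>))) =
      (\<Sum>m=1..n. (\<Sum>\<alpha>\<in>pos_roots n. ?h m \<alpha>)\<^sup>2)"
  proof -
    have "of_real (bilin n \<alpha> \<beta>) \<odot> (elt (reflection n \<alpha>) * elt (reflection n \<beta>)) =
        (\<Sum>m=1..n. ?h m \<alpha> * ?h m \<beta>)" for \<alpha> \<beta>
    proof -
      have "?h m \<alpha> * ?h m \<beta> =
          of_real (\<alpha> m * \<beta> m) \<odot> (elt (reflection n \<alpha>) * elt (reflection n \<beta>))" for m
      proof -
        have "?h m \<alpha> * ?h m \<beta> = of_real (\<alpha> m) \<odot> (elt (reflection n \<alpha>) * ?h m \<beta>)"
          by (simp add: scale_eq[of "of_real (\<alpha> m)"] mult.assoc)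
        also have "\<dots> = of_real (\<alpha> m) \<odot> (of_real (\<beta> m) \<odot> (elt (reflection n \<alpha>) * elt (reflection n \<beta>)))"
          by (simp add: elt_mult_scale)
        also have "\<dots> = of_real (\<alpha> m * \<beta> m) \<odot> (elt (reflection n \<alpha>) * elt (reflection n \<beta>))"
          by (simp add: scale_eq mult_single flip: mult.assoc)
        finally show ?thesis .
      qed
      then show ?thesis
        unfolding bilin_def
        by (intro poly_mapping_eqI) (simp add: lookup_sum sum_distrib_right)
    qed
    then show ?thesis
      by (simp add: power2_eq_square sum_product sum.swap[of _ "pos_roots n" "{Suc 0..n}"])
  qed
  ultimately show ?thesis
    unfolding Omega_def by (simp only: cong: sum.cong)
qed

lemma Omega_eq_three_cycles: "Omega n = (1/4) \<odot> (of_nat (2 * (n choose 2)) + e123 n)"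
proof -
  let ?s = "\<lambda>x y. elt (Perm.swap x y)"
  let ?D = "{1..n}"
  let ?U = "\<lambda>m. \<Sum>x | x \<in> ?D \<and> m < x. ?s x m" and ?T = "\<lambda>m. \<Sum>x | x \<in> ?D \<and> x < m. ?s x m"
  have T: "(\<Sum>m\<in>?D. (?T m)\<^sup>2) = of_nat (n choose 2) + e123 n"
    using sum_jucys_murphy_squares[where t = id and D = ?D and n = n and L = "(<)"] by fastforce
  have U: "(\<Sum>m\<in>?D. (?U m)\<^sup>2) = of_nat (n choose 2) + e123 n"
    using sum_jucys_murphy_squares[where t = id and D = ?D and n = n and L = "(>)"] by fastforce
  have TU: "(\<Sum>m\<in>?D. ?T m * ?U m + ?U m * ?T m) = e123 n"
  proof -
    \<comment> \<open>Exactly one rotation of a triple puts its median last. \<open>?S1\<close> and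
      \<open>?S2\<close> separate the two ways to surround z, giving the products in the orders T U
      and U T.\<close>
    let ?R = "\<lambda>x y z. (x < z \<and> z < y) \<or> (y < z \<and> z < (x::nat))"
    let ?S1 = "SIGMA z:?D. {x \<in> ?D. x < z} \<times> {y \<in> ?D. z < y}"
    let ?S2 = "SIGMA z:?D. {x \<in> ?D. z < x} \<times> {y \<in> ?D. y < z}"
    have fin: "finite ?S1" "finite ?S2" by simp_all
    have "e123 n = (\<Sum>(x, y, z)\<in>{(x, y, z) \<in> ?D \<times> ?D \<times> ?D. distinct [x, y, z] \<and> ?R x y z}.
        ?s (id x) (id z) * ?s (id y) (id z))"
      by (rule e123_eq_sum_oriented[where R = ?R]) (auto simp: bij_betw_def)
    also have "\<dots> = (\<Sum>(z, x, y)\<in>?S1 \<union> ?S2. ?s x z * ?s y z)"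
      by (rule sum.reindex_bij_witness[of _ "\<lambda>(z, x, y). (x, y, z)" "\<lambda>(x, y, z). (z, x, y)"]) auto
    also have "\<dots> = (\<Sum>(z, x, y)\<in>?S1. ?s x z * ?s y z) + (\<Sum>(z, x, y)\<in>?S2. ?s x z * ?s y z)"
      using fin by (intro sum.union_disjoint) auto
    also have "(\<Sum>(z, x, y)\<in>?S1. ?s x z * ?s y z) = (\<Sum>z\<in>?D. ?T z * ?U z)"
      by (subst sum.Sigma[symmetric]) (auto simp: sum_product sum.cartesian_product)
    also have "(\<Sum>(z, x, y)\<in>?S2. ?s x z * ?s y z) = (\<Sum>z\<in>?D. ?U z * ?T z)"
      by (subst sum.Sigma[symmetric]) (auto simp: sum_product sum.cartesian_product)
    finally show ?thesis
      by (simp add: sum.distrib)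
  qed
  \<comment> \<open>The two families of squares contribute \<open>e123 n\<close> twice and the mixed
    terms remove it once.\<close>
  have "(?U m - ?T m)\<^sup>2 = (?U m)\<^sup>2 + (?T m)\<^sup>2 - (?T m * ?U m + ?U m * ?T m)" for m
    by (simp add: power2_eq_square algebra_simps)
  then have "(\<Sum>m\<in>?D. (?U m - ?T m)\<^sup>2) = of_nat (2 * (n choose 2)) + e123 n"
    by (simp only: sum_subtractf sum.distrib[of "\<lambda>m. (?U m)\<^sup>2"] T U TU) (simp add: mult_2)
  then show ?thesis
    by (simp add: Omega_eq_sum_squares)
qed

subsection \<open>Jucys-Murphy elements between row and column sums\<close>

lemma apply_swap_image:
  assumes "a \<in> S \<longleftrightarrow> b \<in> S"
  shows "Perm.apply (Perm.swap a b) ` S = S"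
proof -
  have *: "Perm.apply (Perm.swap a b) x \<in> S" if "x \<in> S" for x
    using assms that by (cases "x = a"; cases "x = b") simp_all
  show ?thesis
  proof (intro equalityI subsetI)
    fix x assume "x \<in> S"
    then show "x \<in> Perm.apply (Perm.swap a b) ` S"
      by (intro image_eqI[OF _ *]) (simp_all add: apply_sequence)
  qed (use * in blast)
qed

lemma sign_swap_mult:
  assumes "a \<noteq> b"
  shows "sign (Perm.apply (Perm.swap a b * q)) = - sign (Perm.apply q)"
proof -
  have "permutation (Perm.apply w)" for w :: "'a perm"
    using finite_affected[of w] by (simp add: permutation in_affected[symmetric])
  moreover have "Perm.apply (Perm.swap a b) = transpose a b"
    by (simp add: swap.rep_eq)
  ultimately show ?thesis
    using assms by (simp add: apply_times sign_compose sign_swap_id permutation_swap_id)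
qed

text \<open>The complex coefficients have characteristic zero; this turns a sign change into
  vanishing in \<open>sandwich_eq_0\<close>.\<close>

lemma perm_algebra_eq_uminus_self:
  fixes x :: perm_algebra
  assumes "x = - x"
  shows "x = 0"
proof (rule poly_mapping_eqI)
  fix w
  have "Poly_Mapping.lookup x w = - Poly_Mapping.lookup x w"
    using assms by (metis lookup_uminus)
  then show "Poly_Mapping.lookup x w = Poly_Mapping.lookup 0 w"
    by simp
qed

lemma apply_times_image: "Perm.apply (p * q) ` S = Perm.apply p ` Perm.apply q ` S"
  by (simp add: apply_times image_comp)

locale young_tableau =
  fixes n :: nat and lam :: "nat list" and t :: "nat \<times> nat \<Rightarrow> nat"
  assumes partition: "partition_of lam n" and tableau: "tableau n lam t"
begin

abbreviation "D \<equiv> diagram lam"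

abbreviation "s x y \<equiv> elt (Perm.swap (t x) (t y))"

definition "rowsum = (\<Sum>p\<in>row_stabilizer n lam t. elt p)"

definition "colsum = (\<Sum>q\<in>col_stabilizer n lam t. of_int (sign (Perm.apply q)) \<odot> elt q)"

lemma young_symmetrizer_eq: "young_symmetrizer n lam t = rowsum * colsum"
  by (simp add: young_symmetrizer_def rowsum_def colsum_def)

lemma t_eq_iff: "x \<in> D \<Longrightarrow> y \<in> D \<Longrightarrow> t x = t y \<longleftrightarrow> x = y"
  using tableau by (auto simp: tableau_def bij_betw_def inj_on_def)

lemma swap_in_sym_group: "x \<in> D \<Longrightarrow> y \<in> D \<Longrightarrow> Perm.swap (t x) (t y) \<in> sym_group n"
  using tableau affected_swap[of "t x" "t y"]
  by (cases "t x = t y") (auto simp: sym_group_def tableau_def bij_betw_def)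

lemma sym_group_mult: "p \<in> sym_group n \<Longrightarrow> q \<in> sym_group n \<Longrightarrow> p * q \<in> sym_group n"
  unfolding sym_group_def using affected_times[of p q] by blast

lemma swap_in_row_stabilizer:
  assumes "x \<in> D" "y \<in> D" "fst x = fst y"
  shows "Perm.swap (t x) (t y) \<in> row_stabilizer n lam t"
  unfolding row_stabilizer_def
  using assms by (auto intro!: swap_in_sym_group apply_swap_image simp: t_eq_iff image_iff)

lemma swap_in_col_stabilizer:
  assumes "x \<in> D" "y \<in> D" "snd x = snd y"
  shows "Perm.swap (t x) (t y) \<in> col_stabilizer n lam t"
  unfolding col_stabilizer_def
  using assms by (auto intro!: swap_in_sym_group apply_swap_image simp: t_eq_iff image_iff)

lemma row_stabilizer_mult:
  "p \<in> row_stabilizer n lam t \<Longrightarrow> q \<in> row_stabilizer n lam t \<Longrightarrow> p * q \<in> row_stabilizer n lam t"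
  by (simp add: row_stabilizer_def sym_group_mult apply_times_image)

lemma col_stabilizer_mult:
  "p \<in> col_stabilizer n lam t \<Longrightarrow> q \<in> col_stabilizer n lam t \<Longrightarrow> p * q \<in> col_stabilizer n lam t"
  by (simp add: col_stabilizer_def sym_group_mult apply_times_image)

text \<open>Right multiplication by an element of the row stabilizer permutes the summands; a
  transposition is its own inverse, so it serves as both reindexing maps.\<close>

lemma rowsum_mult_swap:
  assumes "x \<in> D" "y \<in> D" "fst x = fst y"
  shows "rowsum * s x y = rowsum"
proof -
  let ?w = "Perm.swap (t x) (t y)"
  have w: "?w \<in> row_stabilizer n lam t"
    using assms by (rule swap_in_row_stabilizer)
  have "rowsum * s x y = (\<Sum>p\<in>row_stabilizer n lam t. elt (p * ?w))"
    by (simp add: rowsum_def sum_distrib_right elt_mult)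
  also have "\<dots> = rowsum"
    unfolding rowsum_def
    by (rule sum.reindex_bij_witness[of _ "\<lambda>p. p * ?w" "\<lambda>p. p * ?w"])
      (simp_all add: mult.assoc row_stabilizer_mult w)
  finally show ?thesis .
qed

lemma swap_mult_colsum:
  assumes "x \<in> D" "y \<in> D" "snd x = snd y" "x \<noteq> y"
  shows "s x y * colsum = - colsum"
proof -
  let ?w = "Perm.swap (t x) (t y)"
  have w: "?w \<in> col_stabilizer n lam t"
    using assms(1-3) by (rule swap_in_col_stabilizer)
  have sgn: "sign (Perm.apply (?w * q)) = - sign (Perm.apply q)" for q
    using assms by (intro sign_swap_mult) (simp add: t_eq_iff)
  have colsum: "colsum = (\<Sum>q\<in>col_stabilizer n lam t. of_int (sign (Perm.apply q)) * elt q)"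
    by (simp add: colsum_def scale_eq)
  have "s x y * colsum = (\<Sum>q\<in>col_stabilizer n lam t. of_int (sign (Perm.apply q)) * elt (?w * q))"
    by (simp add: colsum sum_distrib_left mult_of_int_commute mult.assoc[symmetric] elt_mult)
  also have "\<dots> = (\<Sum>q\<in>col_stabilizer n lam t. - (of_int (sign (Perm.apply q)) * elt q))"
    by (rule sum.reindex_bij_witness[of _ "\<lambda>q. ?w * q" "\<lambda>q. ?w * q"])
      (simp_all add: mult.assoc[symmetric] col_stabilizer_mult w sgn)
  also have "\<dots> = - colsum"
    by (simp add: colsum sum_negf)
  finally show ?thesis .
qed

text \<open>Since g (x y) = (gx gy) g on entries, the transposition can be absorbed by
  \<open>rowsum\<close> on the left without a sign or by \<open>colsum\<close> on the right with a
  sign.\<close>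

lemma sandwich_eq_0:
  assumes "x \<in> D" "y \<in> D" "x \<noteq> y" "snd x = snd y"
    and "x' \<in> D" "y' \<in> D" "fst x' = fst y'"
    and "t x' = Perm.apply g (t x)" "t y' = Perm.apply g (t y)"
  shows "rowsum * elt g * colsum = 0"
proof (rule perm_algebra_eq_uminus_self)
  have "rowsum * elt g * colsum = - (rowsum * elt g * (s x y * colsum))"
    using assms by (simp add: swap_mult_colsum)
  also have "\<dots> = - (rowsum * (elt g * s x y) * colsum)"
    by (simp add: mult.assoc)
  also have "elt g * s x y = s x' y' * elt g"
    using mult_swap[of g "t x" "t y"] assms by (simp add: elt_mult)
  also have "rowsum * (s x' y' * elt g) * colsum = rowsum * s x' y' * elt g * colsum"
    by (simp add: mult.assoc)
  also have "rowsum * s x' y' = rowsum"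
    using assms(5-7) by (rule rowsum_mult_swap)
  finally show "rowsum * elt g * colsum = - (rowsum * elt g * colsum)" .
qed

section \<open>Evaluation of the Jucys-Murphy squares row by row\<close>

abbreviation "L r \<equiv> lam ! (r - 1)"

lemma mem_diagram_iff: "(r, c) \<in> D \<longleftrightarrow> 1 \<le> r \<and> r \<le> length lam \<and> 1 \<le> c \<and> c \<le> L r"
  by (auto simp: diagram_def)

lemma diagram_down:
  assumes "(r, c) \<in> D" "1 \<le> r'" "r' \<le> r" "1 \<le> c'" "c' \<le> c"
  shows "(r', c') \<in> D"
proof -
  have "L r \<le> L r'"
  proof (cases "r' = r")
    case False
    then show ?thesis
      using partition assms unfolding partition_of_def mem_diagram_iff
      by (auto dest!: sorted_wrt_nth_less[of _ _ "r' - 1" "r - 1"])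
  qed simp
  then show ?thesis
    using assms unfolding mem_diagram_iff by linarith
qed

lemma sandwich_swap:
  assumes x: "x \<in> D" and z: "z \<in> D" and less: "fst x < fst z"
  shows "rowsum * s x z * colsum = (if snd x = snd z then - (rowsum * colsum) else 0)"
proof (cases "snd x = snd z")
  case True
  moreover have "x \<noteq> z"
    using less by auto
  ultimately show ?thesis
    using swap_mult_colsum[OF x z] by (simp add: mult.assoc)
next
  case False
  \<comment> \<open>The corner y lies above z, hence in the diagram. The swap fixes y and moves z to
    x, so the column pair z, y lands in one row.\<close>
  define y where "y = (fst x, snd z)"
  have y: "y \<in> D"
    unfolding y_def by (rule diagram_down[of "fst z" "snd z"])
      (use assms in \<open>auto simp: mem_diagram_iff[of "fst x" "snd x", simplified] mem_diagram_iff[of "fst z" "snd z", simplified]\<close>)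
  have "y \<noteq> x" "y \<noteq> z"
    using less False by (auto simp: y_def prod_eq_iff)
  then have "rowsum * s x z * colsum = 0"
    using x y z less by (intro sandwich_eq_0[of z y x y]) (auto simp: y_def apply_swap t_eq_iff)
  then show ?thesis
    using False by simp
qed

text \<open>
  \<open>U r z\<close> and \<open>R z\<close> are the parts of the Jucys-Murphy element of \<open>z\<close> coming from the row \<open>r\<close> above
  \<open>z\<close> and from the boxes to the left of \<open>z\<close> in its own row.
\<close>

definition "U r z = (\<Sum>j=1..L r. s (r, j) z)"

definition "R z = (\<Sum>j\<in>{1..<snd z}. s (fst z, j) z)"

text \<open>Only the box of row r in the column of z contributes, and this box exists because it
  lies above z.\<close>

lemma sum_row_above:
  assumes z: "z \<in> D" and r: "1 \<le> r" "r < fst z"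
    and f: "\<And>j. (r, j) \<in> D \<Longrightarrow> f j = (if j = snd z then y else 0)"
  shows "(\<Sum>j=1..L r. f j) = y"
proof -
  have "(r, snd z) \<in> D"
    by (rule diagram_down[of "fst z" "snd z"]) (use z r mem_diagram_iff[of "fst z" "snd z"] in auto)
  then have *: "snd z \<in> {1..L r}" "r \<le> length lam"
    by (simp_all add: mem_diagram_iff)
  have "(\<Sum>j=1..L r. f j) = (\<Sum>j=1..L r. if j = snd z then y else 0)"
    using * r by (intro sum.cong refl f) (simp add: mem_diagram_iff)
  then show ?thesis
    using *(1) by simp
qed

lemma sandwich_U:
  assumes z: "z \<in> D" and r: "1 \<le> r" "r < fst z"
  shows "rowsum * U r z * colsum = - (rowsum * colsum)"
  unfolding U_def sum_distrib_left sum_distrib_right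
  by (rule sum_row_above[OF z r]) (use z r in \<open>simp add: sandwich_swap\<close>)

text \<open>The identity (x z)(y z) = (y z)(x y) lets \<open>rowsum\<close> absorb (y z), since y
  and z share a row. What remains is the sum over the row r for y in place of z.\<close>

lemma sandwich_U_row:
  assumes z: "z \<in> D" and r: "1 \<le> r" "r < fst z" and y: "y \<in> D" "fst y = fst z" "y \<noteq> z"
  shows "rowsum * (U r z * s y z) * colsum = - (rowsum * colsum)"
proof -
  have "rowsum * (s x z * s y z) * colsum = rowsum * s x y * colsum"
    if x: "x \<in> D" "fst x = r" for x
  proof -
    have "distinct [t x, t y, t z]"
      using x y z r by (auto simp: t_eq_iff)
    then have "s x z * s y z = s y z * s x y"
      using swap_mult_swap_factors(1) by (metis elt_mult)
    then have "rowsum * (s x z * s y z) * colsum = rowsum * s y z * s x y * colsum"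
      by (simp add: mult.assoc)
    then show ?thesis
      using y z by (simp add: rowsum_mult_swap)
  qed
  then show ?thesis
    unfolding U_def sum_distrib_left sum_distrib_right
    by (intro sum_row_above[of y]) (use y r in \<open>simp_all add: sandwich_swap\<close>)
qed

text \<open>Write l for \<open>L r1\<close>, a for \<open>rowsum\<close> and b for
  \<open>colsum\<close>. If the rows agree, the diagonal gives l copies of a b, and each
  off-diagonal (x z)(y z) = (x y)(x z) reduces to (x z), which gives -(l - 1) a b. If they differ,
  only both boxes in the column of z survive, with sign (-1)(-1).\<close>

lemma sandwich_U_U:
  assumes z: "z \<in> D" and r1: "1 \<le> r1" "r1 < fst z" and r2: "1 \<le> r2" "r2 < fst z"
  shows "rowsum * (U r1 z * U r2 z) * colsum = rowsum * colsum"
proof -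
  have above: "(r, snd z) \<in> D" if "1 \<le> r" "r < fst z" for r
    by (rule diagram_down[of "fst z" "snd z"]) (use z that mem_diagram_iff[of "fst z" "snd z"] in auto)
  show ?thesis
  proof (cases "r1 = r2")
    case True
    have mem: "(r1, j) \<in> D" if "j \<in> {1..L r1}" for j
      using above[OF r1] that r1 by (simp add: mem_diagram_iff)
    have *: "rowsum * (s (r1, i) z * s (r1, j) z) * colsum =
        (if i = j then rowsum * colsum else rowsum * s (r1, i) z * colsum)"
      if ij: "i \<in> {1..L r1}" "j \<in> {1..L r1}" for i j
    proof (cases "i = j")
      case True
      then show ?thesis by (simp add: elt_mult elt_one)
    next
      case False
      let ?x = "(r1, i)" and ?y = "(r1, j)"
      have "distinct [t ?x, t ?y, t z]"
        using mem[OF ij(1)] mem[OF ij(2)] z r1 False by (auto simp: t_eq_iff)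
      then have "s ?x z * s ?y z = s ?x ?y * s ?x z"
        using swap_mult_swap_factors(2) by (metis elt_mult)
      then have "rowsum * (s ?x z * s ?y z) * colsum = rowsum * s ?x ?y * s ?x z * colsum"
        by (simp add: mult.assoc)
      then show ?thesis
        using False mem[OF ij(1)] mem[OF ij(2)] by (simp add: rowsum_mult_swap)
    qed
    \<comment> \<open>The row is nonempty, so the natural number \<open>L r1 - 1\<close> below is
      not truncated.\<close>
    have pos: "1 \<le> L r1"
      using above[OF r1] by (simp add: mem_diagram_iff)
    have "rowsum * (U r1 z * U r1 z) * colsum =
        (\<Sum>i=1..L r1. \<Sum>j=1..L r1. rowsum * (s (r1, i) z * s (r1, j) z) * colsum)"
      unfolding U_def sum_product by (simp add: sum_distrib_left sum_distrib_right)
    also have "\<dots> = (\<Sum>i=1..L r1. \<Sum>j=1..L r1.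
        if i = j then rowsum * colsum else rowsum * s (r1, i) z * colsum)"
      by (intro sum.cong refl *)
    also have "\<dots> = (\<Sum>i=1..L r1. rowsum * colsum + of_nat (L r1 - 1) * (rowsum * s (r1, i) z * colsum))"
    proof (intro sum.cong refl)
      fix i assume i: "i \<in> {1..L r1}"
      show "(\<Sum>j=1..L r1. if i = j then rowsum * colsum else rowsum * s (r1, i) z * colsum) =
          rowsum * colsum + of_nat (L r1 - 1) * (rowsum * s (r1, i) z * colsum)"
      proof -
        have "(\<Sum>j\<in>{1..L r1} - {i}. if i = j then rowsum * colsum else rowsum * s (r1, i) z * colsum) =
            (\<Sum>j\<in>{1..L r1} - {i}. rowsum * s (r1, i) z * colsum)"
          by (intro sum.cong) auto
        then show ?thesis
          using i by (subst sum.remove[OF _ i]) simp_all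
      qed
    qed
    also have "\<dots> = of_nat (L r1) * (rowsum * colsum) + of_nat (L r1 - 1) * (rowsum * U r1 z * colsum)"
      by (simp add: sum.distrib U_def sum_distrib_left sum_distrib_right)
    also have "\<dots> = rowsum * colsum"
      unfolding sandwich_U[OF z r1] using pos by (simp add: of_nat_diff left_diff_distrib)
    finally show ?thesis
      using True by simp
  next
    case False
    have eq: "rowsum * (s x z * s y z) * colsum =
        (if snd x = snd z then if snd y = snd z then rowsum * colsum else 0 else 0)"
      if x: "x \<in> D" "fst x = r1" and y: "y \<in> D" "fst y = r2" for x y
    proof -
      have d: "x \<noteq> y" "x \<noteq> z" "y \<noteq> z"
        using x y False r1 r2 by auto
      \<comment> \<open>In case 1 the product sends z to y, in case 2 it sends y to x. In both it
        fixes the box \<open>?v\<close> in the column of z, so a column pair lands in one row; in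
        case 3 \<open>colsum\<close> absorbs both factors.\<close>
      consider "snd y \<noteq> snd z" | "snd x \<noteq> snd z" "snd y = snd z" | "snd x = snd z" "snd y = snd z"
        by blast
      then show ?thesis
      proof cases
        case 1
        let ?v = "(r2, snd z)"
        have "?v \<noteq> x" "?v \<noteq> y" "?v \<noteq> z"
          using 1 x y False r2 by (auto simp: prod_eq_iff)
        then have "rowsum * elt (Perm.swap (t x) (t z) * Perm.swap (t y) (t z)) * colsum = 0"
          using x y z d above[OF r2]
          by (intro sandwich_eq_0[of z ?v y ?v]) (auto simp: apply_times apply_swap t_eq_iff)
        then show ?thesis
          using 1 by (simp add: elt_mult)
      next
        case 2
        let ?v = "(r1, snd z)"
        have "?v \<noteq> x" "?v \<noteq> y" "?v \<noteq> z"
          using 2 x y False r1 by (auto simp: prod_eq_iff)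
        then have "rowsum * elt (Perm.swap (t x) (t z) * Perm.swap (t y) (t z)) * colsum = 0"
          using x y z d above[OF r1] 2
          by (intro sandwich_eq_0[of y ?v x ?v]) (auto simp: apply_times apply_swap t_eq_iff)
        then show ?thesis
          using 2 by (simp add: elt_mult)
      next
        case 3
        then show ?thesis
          using x y z d by (simp add: mult.assoc swap_mult_colsum)
      qed
    qed
    have "rowsum * (U r1 z * U r2 z) * colsum =
        (\<Sum>i=1..L r1. \<Sum>j=1..L r2. rowsum * (s (r1, i) z * s (r2, j) z) * colsum)"
      unfolding U_def sum_product by (simp add: sum_distrib_left sum_distrib_right)
    also have "\<dots> = rowsum * colsum"
    proof (rule sum_row_above[OF z r1])
      fix i assume i: "(r1, i) \<in> D"
      show "(\<Sum>j=1..L r2. rowsum * (s (r1, i) z * s (r2, j) z) * colsum) =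
          (if i = snd z then rowsum * colsum else 0)"
        by (rule sum_row_above[OF z r2]) (use eq i in auto)
    qed
    finally show ?thesis .
  qed
qed

text \<open>With h rows above z and k boxes to its left, the content is k - h. The two parts act
  like k and -h, but as they need not commute, the four ordered products are evaluated
  separately.\<close>

lemma sandwich_jucys_murphy_square:
  assumes z: "z \<in> D"
  shows "rowsum * (R z + (\<Sum>r\<in>{1..<fst z}. U r z))\<^sup>2 * colsum = of_int ((content z)\<^sup>2) * (rowsum * colsum)"
proof -
  let ?S = "\<Sum>r\<in>{1..<fst z}. U r z"
  define h where "h = int (fst z) - 1"
  define k where "k = int (snd z) - 1"
  have pos: "1 \<le> fst z" "1 \<le> snd z"
    using z mem_diagram_iff[of "fst z" "snd z"] by auto
  have row: "(fst z, j) \<in> D" if "j \<in> {1..<snd z}" for j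
    by (rule diagram_down[of "fst z" "snd z"]) (use that z pos in auto)
  have card: "of_nat (card {1..<fst z}) = (of_int h :: perm_algebra)"
    "of_nat (card {1..<snd z}) = (of_int k :: perm_algebra)"
    using pos by (simp_all add: h_def k_def of_nat_diff)
  have R: "rowsum * R z = of_int k * rowsum"
  proof -
    have "rowsum * R z = (\<Sum>j\<in>{1..<snd z}. rowsum)"
      unfolding R_def sum_distrib_left using row z by (intro sum.cong) (simp_all add: rowsum_mult_swap)
    then show ?thesis
      using card by (simp add: mult_of_int_commute)
  qed
  have S: "rowsum * ?S * colsum = - of_int h * (rowsum * colsum)"
  proof -
    have "rowsum * ?S * colsum = (\<Sum>r\<in>{1..<fst z}. - (rowsum * colsum))"
      unfolding sum_distrib_left sum_distrib_right using z by (intro sum.cong) (simp_all add: sandwich_U)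
    then show ?thesis
      using card by simp
  qed
  have SR: "rowsum * (?S * R z) * colsum = - of_int (h * k) * (rowsum * colsum)"
  proof -
    have "rowsum * (?S * R z) * colsum =
        (\<Sum>r\<in>{1..<fst z}. \<Sum>j\<in>{1..<snd z}. rowsum * (U r z * s (fst z, j) z) * colsum)"
      unfolding R_def sum_product by (simp add: sum_distrib_left sum_distrib_right)
    also have "\<dots> = (\<Sum>r\<in>{1..<fst z}. \<Sum>j\<in>{1..<snd z}. - (rowsum * colsum))"
      using z row by (intro sum.cong refl sandwich_U_row) (auto simp: prod_eq_iff)
    finally show ?thesis
      using card by (simp add: mult.assoc)
  qed
  have SS: "rowsum * (?S * ?S) * colsum = of_int (h * h) * (rowsum * colsum)"
  proof -
    have "rowsum * (?S * ?S) * colsum =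
        (\<Sum>r\<in>{1..<fst z}. \<Sum>r'\<in>{1..<fst z}. rowsum * (U r z * U r' z) * colsum)"
      unfolding sum_product by (simp add: sum_distrib_left sum_distrib_right)
    also have "\<dots> = (\<Sum>r\<in>{1..<fst z}. \<Sum>r'\<in>{1..<fst z}. rowsum * colsum)"
      using z by (intro sum.cong refl sandwich_U_U) auto
    finally show ?thesis
      by (simp only: sum_constant card of_int_mult mult.assoc)
  qed
  have RR: "rowsum * (R z * R z) * colsum = of_int (k * k) * (rowsum * colsum)"
    by (simp add: R mult.assoc[symmetric]) (simp add: R mult.assoc)
  have RS: "rowsum * (R z * ?S) * colsum = - of_int (k * h) * (rowsum * colsum)"
  proof -
    have "rowsum * (R z * ?S) * colsum = of_int k * (rowsum * ?S * colsum)"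
      by (simp only: R mult.assoc[symmetric])
    then show ?thesis
      unfolding S by (simp add: mult.assoc)
  qed
  have "rowsum * (R z + ?S)\<^sup>2 * colsum = rowsum * (R z * R z) * colsum + rowsum * (R z * ?S) * colsum +
      rowsum * (?S * R z) * colsum + rowsum * (?S * ?S) * colsum"
    by (simp only: power2_eq_square distrib_left distrib_right add.assoc add.commute add.left_commute)
  also have "\<dots> = of_int (k * k - k * h - h * k + h * h) * (rowsum * colsum)"
    unfolding RR RS SR SS
    by (simp only: of_int_add of_int_diff distrib_right left_diff_distrib
      minus_mult_left[symmetric] add_uminus_conv_diff)
  also have "k * k - k * h - h * k + h * h = (content z)\<^sup>2"
    by (simp add: content_def h_def k_def power2_eq_square algebra_simps)
  finally show ?thesis .
qed

lemma sandwich_e123: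
  "rowsum * e123 n * colsum = (of_int (content_power_sum 2 lam) - of_nat (n choose 2)) * (rowsum * colsum)"
proof -
  \<comment> \<open>Reading order: the predecessors of z are all boxes in higher rows and those to
    its left in its own row.\<close>
  let ?less = "\<lambda>x y :: nat \<times> nat. fst x < fst y \<or> fst x = fst y \<and> snd x < snd y"
  have t: "bij_betw t D {1..n}"
    using tableau by (simp add: tableau_def)
  have "(\<Sum>x | x \<in> D \<and> ?less x z. s x z) = R z + (\<Sum>r\<in>{1..<fst z}. U r z)" if z: "z \<in> D" for z
  proof -
    let ?A = "SIGMA r:{1..<fst z}. {1..L r}"
    have z': "1 \<le> fst z" "fst z \<le> length lam" "1 \<le> snd z" "snd z \<le> L (fst z)"
      using z mem_diagram_iff[of "fst z" "snd z"] by auto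
    have "{x \<in> D. ?less x z} = Pair (fst z) ` {1..<snd z} \<union> ?A"
      using z' by (auto simp: mem_diagram_iff image_iff)
    then have "(\<Sum>x | x \<in> D \<and> ?less x z. s x z) =
        (\<Sum>x\<in>Pair (fst z) ` {1..<snd z}. s x z) + (\<Sum>x\<in>?A. s x z)"
      by (simp only:) (rule sum.union_disjoint, auto)
    moreover have "(\<Sum>x\<in>Pair (fst z) ` {1..<snd z}. s x z) = R z"
      by (subst sum.reindex) (simp_all add: inj_on_def R_def)
    moreover have "(\<Sum>x\<in>?A. s x z) = (\<Sum>r\<in>{1..<fst z}. U r z)"
      unfolding U_def by (subst sum.Sigma) (simp_all add: case_prod_unfold)
    ultimately show ?thesis by simp
  qed
  moreover have "(\<Sum>z\<in>D. (\<Sum>x | x \<in> D \<and> ?less x z. s x z)\<^sup>2) = of_nat (n choose 2) + e123 n"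
    by (rule sum_jucys_murphy_squares[OF t, where L = ?less]) (auto simp: prod_eq_iff)
  ultimately have "of_nat (n choose 2) + e123 n = (\<Sum>z\<in>D. (R z + (\<Sum>r\<in>{1..<fst z}. U r z))\<^sup>2)"
    by simp
  then have "rowsum * (of_nat (n choose 2) + e123 n) * colsum =
      (\<Sum>z\<in>D. of_int ((content z)\<^sup>2) * (rowsum * colsum))"
    by (simp only: sum_distrib_left sum_distrib_right sandwich_jucys_murphy_square cong: sum.cong)
  also have "\<dots> = of_int (content_power_sum 2 lam) * (rowsum * colsum)"
    by (simp add: content_power_sum_def sum_distrib_right)
  also have "rowsum * (of_nat (n choose 2) + e123 n) * colsum =
      of_nat (n choose 2) * (rowsum * colsum) + rowsum * e123 n * colsum"
    by (simp add: distrib_left distrib_right mult_of_nat_commute mult.assoc)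
  finally show ?thesis
    by (simp add: algebra_simps)
qed

end

section \<open>Scalar action on the left ideals, and the three claims together\<close>

lemma Omega_mult_young_symmetrizer:
  assumes lam: "partition_of lam n" and t: "tableau n lam t" and v: "v \<in> irrep n lam t"
  shows "Omega n * v = (1/4 * of_int (int (n choose 2) + content_power_sum 2 lam)) \<odot> v"
proof -
  interpret young_tableau n lam t
    using lam t by unfold_locales
  let ?C = "content_power_sum 2 lam" and ?N = "int (n choose 2)"
  obtain x where x: "x \<in> group_algebra n" and v: "v = x * (rowsum * colsum)"
    using v by (auto simp: irrep_def young_symmetrizer_eq)
  \<comment> \<open>Centrality moves \<open>e123 n\<close> past x and \<open>rowsum\<close> to the
    place between \<open>rowsum\<close> and \<open>colsum\<close>, where
    \<open>sandwich_e123\<close> evaluates it.\<close>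
  have row: "rowsum * e123 n = e123 n * rowsum"
    unfolding rowsum_def sum_distrib_left sum_distrib_right
    by (intro sum.cong refl elt_commutes_e123) (simp add: row_stabilizer_def)
  have "e123 n * v = (e123 n * x) * (rowsum * colsum)"
    by (simp add: v mult.assoc)
  also have "\<dots> = x * (e123 n * rowsum) * colsum"
    by (simp add: mult.assoc flip: group_algebra_commutes_e123[OF x])
  also have "\<dots> = x * (rowsum * e123 n * colsum)"
    by (simp add: row[symmetric] mult.assoc)
  also have "\<dots> = x * (of_int (?C - ?N) * (rowsum * colsum))"
    by (simp add: sandwich_e123)
  also have "\<dots> = of_int (?C - ?N) * v"
    unfolding v mult.assoc[symmetric] by (simp only: mult_of_int_commute)
  finally have "(of_nat (2 * (n choose 2)) + e123 n) * v = of_int (2 * ?N) * v + of_int (?C - ?N) * v"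
    by (simp add: distrib_right)
  also have "\<dots> = of_int (?N + ?C) * v"
    by (simp only: distrib_right[symmetric] of_int_add[symmetric]) simp
  finally show ?thesis
    by (simp only: Omega_eq_three_cycles scale_eq mult.assoc)
      (simp only: single_of_int[symmetric] mult.assoc[symmetric] mult_single add_0)
qed

theorem lemma4p10:
  fixes n :: nat
  shows
    "Omega n = (1/4) \<odot> ((of_nat n * (of_nat n - 1)) \<odot> 1 + e123 n) \<and>
     Omega n = (1/4) \<odot> ((of_nat n * (of_nat n - 1) / 2) \<odot> 1 + (\<Sum>i=1..n. jucys_murphy i ^ 2)) \<and>
     (\<forall>lam t. partition_of lam n \<longrightarrow> tableau n lam t \<longrightarrow>
        (\<forall>v \<in> irrep n lam t.
           Omega n * v =
             (1/4 * (of_nat n * (of_nat n - 1) / 2 + of_int (content_power_sum 2 lam))) \<odot> v))"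
proof -
  have "2 * (n choose 2) = n * (n - 1)"
    by (cases n) (simp_all add: choose_two)
  \<comment> \<open>The case n = 0 is split off because n - 1 is truncated in the naturals but not
    in the complex numbers.\<close>
  then have N: "of_nat n * (of_nat n - 1) = complex_of_nat (2 * (n choose 2))"
    by (cases n) (simp_all add: algebra_simps)
  have N': "of_nat n * (of_nat n - 1) / 2 = complex_of_nat (n choose 2)"
    unfolding N by simp
  have one: "of_nat k \<odot> 1 = (of_nat k :: perm_algebra)" for k
    by (simp add: scale_eq)
  have "(\<Sum>i=1..n. jucys_murphy i ^ 2) =
      (\<Sum>z\<in>{1..n}. (\<Sum>x | x \<in> {1..n} \<and> x < z. elt (Perm.swap (id x) (id z)))\<^sup>2)"
    unfolding jucys_murphy_def by (intro sum.cong refl arg_cong[where f = "\<lambda>y. y\<^sup>2"]) auto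
  also have "\<dots> = of_nat (n choose 2) + e123 n"
    by (rule sum_jucys_murphy_squares) (auto simp: bij_betw_def)
  finally have JM: "(\<Sum>i=1..n. jucys_murphy i ^ 2) = of_nat (n choose 2) + e123 n" .
  show ?thesis
    unfolding N' unfolding N one JM
    by (auto simp: Omega_mult_young_symmetrizer)
      (simp_all add: Omega_eq_three_cycles mult_2 add.assoc)
qed

end
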